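(* Let $q>2$ be a prime power. If there exists an $[n,k]_{q^2}$ GRS code with $l$-dimensional Hermitian hull, where $0\le l\le k$, then for any $1\le i\le\min\{l,q^2+1-n\}$ and each $0\le s\le l-i$ there exists an $[n+i,k+i]_{q^2}$ MDS code with $s$-dimensional Hermitian hull.
   Context: For a linear code $\mathcal C\subseteq\mathbb F_{q^2}^n$, $\mathcal C^{\perp_H}=\{\bm x:\sum_i y_ix_i^q=0\ \text{for all }\bm y\in\mathcal C\}$, and the Hermitian hull is $\mathrm{Hull}_H(\mathcal C)=\mathcal C\cap\mathcal C^{\perp_H}$. An $[n,k]_{q^2}$ GRS code ($1\le k\le n$) is a code $\{(v_1f(a_1),\dots,v_nf(a_n)):f\in\mathbb F_{q^2}[x],\deg f\le k-1\}$ with distinct $a_j\in\mathbb F_{q^2}$ and $v_j\in\mathbb F_{q^2}^*$. An $[n,k]$ code is MDS if its minimum distance is $n-k+1$. *)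

theory Defs
  imports
    "Jordan_Normal_Form.VS_Connect"
    "HOL-Number_Theory.Prime_Powers"
begin

definition code_dim :: "nat \<Rightarrow> 'a::field vec set \<Rightarrow> nat" where
  "code_dim n C = vectorspace.dim class_ring ((module_vec TYPE('a) n)\<lparr>carrier := C\<rparr>)"

definition linear_code :: "nat \<Rightarrow> nat \<Rightarrow> 'a::field vec set \<Rightarrow> bool" where
  "linear_code n k C \<longleftrightarrow>
     VectorSpace.subspace class_ring C (module_vec TYPE('a) n) \<and> code_dim n C = k"

definition hamming_dist :: "'a vec \<Rightarrow> 'a vec \<Rightarrow> nat" where
  "hamming_dist x y = card {i. i < dim_vec x \<and> x $ i \<noteq> y $ i}"

text \<open>Only meaningful for a code with at least two codewords, since \<^term>\<open>Min {}\<close> is unspecified.\<close>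
definition min_distance :: "'a vec set \<Rightarrow> nat" where
  "min_distance C = Min {hamming_dist x y | x y. x \<in> C \<and> y \<in> C \<and> x \<noteq> y}"

definition MDS_code :: "nat \<Rightarrow> nat \<Rightarrow> 'a::field vec set \<Rightarrow> bool" where
  "MDS_code n k C \<longleftrightarrow> linear_code n k C \<and> min_distance C = n - k + 1"

text \<open>Coordinates are indexed by \<open>0, \<dots>, n - 1\<close>; only the values of \<open>a\<close> and \<open>v\<close> on
  \<^term>\<open>{..<n}\<close> matter.\<close>
definition GRS :: "nat \<Rightarrow> nat \<Rightarrow> (nat \<Rightarrow> 'a::field) \<Rightarrow> (nat \<Rightarrow> 'a) \<Rightarrow> 'a vec set" where
  "GRS n k a v = {vec n (\<lambda>j. v j * poly f (a j)) | f. degree f \<le> k - 1}"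

definition GRS_code :: "nat \<Rightarrow> nat \<Rightarrow> 'a::field vec set \<Rightarrow> bool" where
  "GRS_code n k C \<longleftrightarrow> 1 \<le> k \<and> k \<le> n \<and>
     (\<exists>a v. inj_on a {..<n} \<and> (\<forall>j<n. v j \<noteq> 0) \<and> C = GRS n k a v)"

text \<open>The parameter \<open>q\<close> is the square root of the size of the field.\<close>
definition hermitian_dual :: "nat \<Rightarrow> nat \<Rightarrow> 'a::field vec set \<Rightarrow> 'a vec set" where
  "hermitian_dual q n C = {x \<in> carrier_vec n. \<forall>y\<in>C. (\<Sum>i<n. y $ i * (x $ i) ^ q) = 0}"

definition hermitian_hull :: "nat \<Rightarrow> nat \<Rightarrow> 'a::field vec set \<Rightarrow> 'a vec set" where
  "hermitian_hull q n C = C \<inter> hermitian_dual q n C"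

end

theory Submission
  imports Defs "HOL-Library.Cardinality"
begin

text \<open>Over a finite field the size of a subspace determines its dimension, so dimensions are
  compared by counting.

  Adding an evaluation point to a GRS code and one to the degree bound, with suitably corrected
  multipliers, gives a code whose shortening at the new point is the old code. A word of the old
  hull survives, padded with \<open>0\<close>, as soon as it is orthogonal to one further vector, so each
  extension costs at most one dimension of the hull. Placing the last point at infinity allows the
  length \<open>q\<^sup>2 + 1\<close>.

  The hull can then be shrunk one dimension at a time without losing the MDS property: for \<open>q > 2\<close>
  there is \<open>c \<noteq> 0\<close> with \<open>c ^ (q + 1) \<noteq> 1\<close>, and scaling by \<open>c\<close> a coordinate on which the
  hull does not vanish cuts the hull down to its words that vanish there.\<close>

section \<open>Subspaces of vectors over a finite field and their sizes\<close>

abbreviation subspace_vec :: "nat \<Rightarrow> 'a::field vec set \<Rightarrow> bool" where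
  "subspace_vec n C \<equiv> VectorSpace.subspace class_ring C (module_vec TYPE('a) n)"

lemma subspace_vec_iff:
  fixes C :: "'a::field vec set"
  shows "subspace_vec n C \<longleftrightarrow> C \<subseteq> carrier_vec n \<and> 0\<^sub>v n \<in> C \<and>
    (\<forall>x\<in>C. \<forall>y\<in>C. x + y \<in> C) \<and> (\<forall>c. \<forall>x\<in>C. c \<cdot>\<^sub>v x \<in> C)"
  using vec_vs[of n, where 'a = 'a] vec_module[of n, where 'a = 'a]
  by (auto simp: VectorSpace.subspace_def submodule_def module_vec_simps)

lemma subspace_vecD:
  fixes C :: "'a::field vec set"
  assumes "subspace_vec n C"
  shows "C \<subseteq> carrier_vec n" "0\<^sub>v n \<in> C" "\<And>x y. x \<in> C \<Longrightarrow> y \<in> C \<Longrightarrow> x + y \<in> C"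
    "\<And>c x. x \<in> C \<Longrightarrow> c \<cdot>\<^sub>v x \<in> C"
  using assms unfolding subspace_vec_iff by blast+

lemma subspace_vec_minus:
  fixes C :: "'a::field vec set"
  assumes "subspace_vec n C" "x \<in> C" "y \<in> C"
  shows "x - y \<in> C"
proof -
  have "x - y = x + (-1) \<cdot>\<^sub>v y"
    using assms subspace_vecD(1)[OF assms(1)] by (intro eq_vecI) auto
  then show ?thesis
    using assms subspace_vecD(3,4)[OF assms(1)] by metis
qed

lemma finite_carrier_vec: "finite (carrier_vec n :: 'a::finite vec set)"
proof (rule finite_subset)
  show "carrier_vec n \<subseteq> vec n ` ({..<n} \<rightarrow>\<^sub>E (UNIV :: 'a set))"
  proof
    fix x :: "'a vec" assume "x \<in> carrier_vec n"
    then have "vec n (restrict (\<lambda>i. x $ i) {..<n}) = x" by (intro eq_vecI) auto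
    moreover have "restrict (\<lambda>i. x $ i) {..<n} \<in> {..<n} \<rightarrow>\<^sub>E UNIV" by simp
    ultimately show "x \<in> vec n ` ({..<n} \<rightarrow>\<^sub>E UNIV)" by (metis imageI)
  qed
  show "finite (vec n ` ({..<n} \<rightarrow>\<^sub>E (UNIV :: 'a set)))"
    by (intro finite_imageI finite_PiE) auto
qed

lemma finite_subspace_vec:
  fixes C :: "'a::{finite,field} vec set"
  shows "subspace_vec n C \<Longrightarrow> finite C"
  using finite_subset[OF subspace_vecD(1) finite_carrier_vec] by blast

lemma one_less_CARD: "1 < CARD('a::{finite,field})"
  using card_mono[of UNIV "{0, 1 :: 'a}"] by simp

text \<open>Coordinates with respect to a finite basis \<open>B\<close> match the words of
  \<open>C\<close> with the functions from \<open>B\<close> to the field. This is what lets every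
  later dimension argument be a count.\<close>

lemma card_subspace_vec:
  fixes C :: "'a::{finite,field} vec set"
  assumes "subspace_vec n C"
  shows "card C = CARD('a) ^ code_dim n C"
proof -
  let ?V = "module_vec TYPE('a) n\<lparr>carrier := C\<rparr>"
  interpret W: vectorspace "class_ring :: 'a ring" ?V
    using vectorspace.subspace_is_vs[OF vec_vs assms] .
  have fC: "finite C" using finite_subspace_vec[OF assms] .
  \<comment> \<open>The whole of \<open>C\<close> serves as a finite generating set, so finite
    dimension is immediate.\<close>
  have gen: "W.gen_set C"
    using W.in_own_span[of C] W.span_is_subset2[of C] by auto
  have "W.fin_dim" unfolding W.fin_dim_def using fC gen by (intro exI[of _ C]) auto
  from W.finite_basis_exists[OF this] obtain B where B: "finite B" "W.basis B" by blast
  then have BC: "B \<subseteq> carrier ?V" by (simp add: W.basis_def)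
  have uniq: "\<exists>!a. a \<in> B \<rightarrow>\<^sub>E UNIV \<and> W.lincomb a B = v" if "v \<in> C" for v
    using W.basis_criterion[OF B(1) BC] B(2) that by simp
  have "W.lincomb a B \<in> C" for a
    using W.lincomb_closed[of B a] BC by simp
  then have "bij_betw (\<lambda>a. W.lincomb a B) (B \<rightarrow>\<^sub>E UNIV) C"
    using uniq BC unfolding bij_betw_def inj_on_def image_def by (auto; metis)
  then have "card C = card (B \<rightarrow>\<^sub>E (UNIV :: 'a set))"
    by (simp add: bij_betw_same_card)
  then show ?thesis
    using B by (simp add: card_PiE code_dim_def W.dim_basis)
qed

lemma code_dim_eqI:
  fixes C :: "'a::{finite,field} vec set"
  assumes "subspace_vec n C" "card C = CARD('a) ^ d"
  shows "code_dim n C = d"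
  using assms card_subspace_vec[OF assms(1)] one_less_CARD[where 'a = 'a] by (metis power_inject_exp)

text \<open>Rank-nullity for a nonzero functional, in counting form: \<open>C\<close> is the direct
  sum of a line on which the functional is injective and its kernel.\<close>

lemma card_functional_kernel:
  fixes C :: "'a::{finite,field} vec set" and \<phi> :: "'a vec \<Rightarrow> 'a"
  assumes C: "subspace_vec n C"
    and add: "\<And>x y. x \<in> C \<Longrightarrow> y \<in> C \<Longrightarrow> \<phi> (x + y) = \<phi> x + \<phi> y"
    and smult: "\<And>c x. x \<in> C \<Longrightarrow> \<phi> (c \<cdot>\<^sub>v x) = c * \<phi> x"
    and h: "h \<in> C" "\<phi> h \<noteq> 0"
  shows "card C = CARD('a) * card {x \<in> C. \<phi> x = 0}"
proof -
  note D = subspace_vecD[OF C]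
  \<comment> \<open>Normalised so that the functional is \<open>1\<close> on \<open>g\<close>; the
    coefficient of \<open>g\<close> in a word is then the value of the functional there.\<close>
  define g where "g = inverse (\<phi> h) \<cdot>\<^sub>v h"
  have g: "g \<in> C" "\<phi> g = 1" using h smult D(4) by (auto simp: g_def)
  define \<psi> where "\<psi> = (\<lambda>(c, x). c \<cdot>\<^sub>v g + x)"
  have car: "x \<in> carrier_vec n" if "x \<in> C" for x using that D(1) by auto
  have "bij_betw \<psi> (UNIV \<times> {x \<in> C. \<phi> x = 0}) C"
  proof (rule bij_betw_byWitness[where f' = "\<lambda>x. (\<phi> x, x - \<phi> x \<cdot>\<^sub>v g)"])
    have phi: "\<phi> (c \<cdot>\<^sub>v g + x) = c + \<phi> x" if "x \<in> C" for c x
      using that add smult g D(4) by simp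
    show "\<forall>p\<in>UNIV \<times> {x \<in> C. \<phi> x = 0}. (\<phi> (\<psi> p), \<psi> p - \<phi> (\<psi> p) \<cdot>\<^sub>v g) = p"
    proof clarsimp
      fix c y assume y: "y \<in> C" "\<phi> y = 0"
      have "c \<cdot>\<^sub>v g + y - c \<cdot>\<^sub>v g = y"
        using car[OF g(1)] car[OF y(1)] by (intro eq_vecI) auto
      then show "\<phi> (\<psi> (c, y)) = c \<and> \<psi> (c, y) - \<phi> (\<psi> (c, y)) \<cdot>\<^sub>v g = y"
        using phi[OF y(1)] y(2) by (simp add: \<psi>_def)
    qed
    show "\<forall>x\<in>C. \<psi> (\<phi> x, x - \<phi> x \<cdot>\<^sub>v g) = x"
    proof
      fix x assume x: "x \<in> C"
      show "\<psi> (\<phi> x, x - \<phi> x \<cdot>\<^sub>v g) = x"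
        using car[OF g(1)] car[OF x] unfolding \<psi>_def by (intro eq_vecI) auto
    qed
    show "\<psi> ` (UNIV \<times> {x \<in> C. \<phi> x = 0}) \<subseteq> C"
      using g(1) D(3,4) by (auto simp: \<psi>_def)
    show "(\<lambda>x. (\<phi> x, x - \<phi> x \<cdot>\<^sub>v g)) ` C \<subseteq> UNIV \<times> {x \<in> C. \<phi> x = 0}"
    proof clarsimp
      fix x assume x: "x \<in> C"
      let ?y = "x - \<phi> x \<cdot>\<^sub>v g"
      have y: "?y \<in> C" using subspace_vec_minus[OF C] x g D(4) by blast
      have "\<phi> (\<phi> x \<cdot>\<^sub>v g + ?y) = \<phi> x + \<phi> ?y" using phi y by blast
      moreover have "\<phi> x \<cdot>\<^sub>v g + ?y = x"
        using car[OF g(1)] car[OF x] by (intro eq_vecI) auto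
      ultimately show "?y \<in> C \<and> \<phi> ?y = 0" using y by simp
    qed
  qed
  then show ?thesis by (simp add: bij_betw_same_card[symmetric] card_cartesian_product)
qed

section \<open>MDS codes described by the zeros of their codewords\<close>

text \<open>For \<open>1 \<le> k\<close>, bounding the number of zeros of a codeword by \<open>k - 1\<close> is the lower bound
  \<open>n - k + 1\<close> for the minimum distance; \<open>mds_imp_MDS_code\<close> supplies the Singleton bound.\<close>
definition mds :: "nat \<Rightarrow> nat \<Rightarrow> 'a::{finite,field} vec set \<Rightarrow> bool" where
  "mds n k C \<longleftrightarrow> subspace_vec n C \<and> card C = CARD('a) ^ k \<and> 1 \<le> k \<and> k \<le> n \<and>
     (\<forall>x\<in>C. x \<noteq> 0\<^sub>v n \<longrightarrow> card {i. i < n \<and> x $ i = 0} < k)"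

lemma mds_imp_MDS_code:
  fixes C :: "'a::{finite,field} vec set"
  assumes "mds n k C"
  shows "MDS_code n k C"
proof -
  have C: "subspace_vec n C" and cC: "card C = CARD('a) ^ k" and k: "1 \<le> k" "k \<le> n"
    and zeros: "\<And>x. x \<in> C \<Longrightarrow> x \<noteq> 0\<^sub>v n \<Longrightarrow> card {i. i < n \<and> x $ i = 0} < k"
    using assms unfolding mds_def by auto
  note D = subspace_vecD[OF C]
  let ?D = "{hamming_dist x y | x y. x \<in> C \<and> y \<in> C \<and> x \<noteq> y}"
  have split: "hamming_dist x y + card {i. i < n \<and> x $ i = y $ i} = n"
    if "x \<in> C" for x y
  proof -
    have "card ({i. i < n \<and> x $ i \<noteq> y $ i} \<union> {i. i < n \<and> x $ i = y $ i}) =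
        card {i. i < n \<and> x $ i \<noteq> y $ i} + card {i. i < n \<and> x $ i = y $ i}"
      by (rule card_Un_disjoint) auto
    moreover have "{i. i < n \<and> x $ i \<noteq> y $ i} \<union> {i. i < n \<and> x $ i = y $ i} = {..<n}" by auto
    moreover have "dim_vec x = n" using D(1) that by auto
    ultimately show ?thesis by (simp add: hamming_dist_def)
  qed
  have lower: "n - k + 1 \<le> hamming_dist x y" if xy: "x \<in> C" "y \<in> C" "x \<noteq> y" for x y
  proof -
    have car: "x \<in> carrier_vec n" "y \<in> carrier_vec n" using D(1) xy by auto
    have "x - y \<noteq> 0\<^sub>v n"
    proof
      assume eq: "x - y = 0\<^sub>v n"
      have "x $ i = y $ i" if "i < n" for i
        using arg_cong[OF eq, of "\<lambda>z. z $ i"] car that by simp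
      then show False using xy(3) car by (auto intro!: eq_vecI)
    qed
    then have "card {i. i < n \<and> (x - y) $ i = 0} < k"
      using zeros subspace_vec_minus[OF C] xy by blast
    moreover have "{i. i < n \<and> (x - y) $ i = 0} = {i. i < n \<and> x $ i = y $ i}"
      using car by auto
    ultimately show ?thesis using split[OF xy(1), of y] k by simp
  qed
  \<comment> \<open>Singleton bound by pigeonhole: there are more codewords than patterns on the
    first \<open>k - 1\<close> coordinates, so two distinct words agree there.\<close>
  have "\<exists>x\<in>C. \<exists>y\<in>C. x \<noteq> y \<and> hamming_dist x y \<le> n - k + 1"
  proof -
    let ?r = "\<lambda>x. restrict (($) x) {..<k - 1} :: nat \<Rightarrow> 'a"
    have "card (?r ` C) \<le> card ({..<k - 1} \<rightarrow>\<^sub>E (UNIV :: 'a set))"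
      by (intro card_mono finite_PiE image_subsetI) auto
    also have "\<dots> = CARD('a) ^ (k - 1)" by (simp add: card_PiE)
    also have "\<dots> < card C" using cC k one_less_CARD[where 'a = 'a] by simp
    finally have "\<not> inj_on ?r C" using pigeonhole by blast
    then obtain x y where xy: "x \<in> C" "y \<in> C" "x \<noteq> y" "?r x = ?r y"
      unfolding inj_on_def by blast
    have "x $ i = y $ i" if "i < k - 1" for i
      using fun_cong[OF xy(4), of i] that by simp
    then have "{..<k - 1} \<subseteq> {i. i < n \<and> x $ i = y $ i}" using k by auto
    then have "k - 1 \<le> card {i. i < n \<and> x $ i = y $ i}"
      using card_mono[of "{i. i < n \<and> x $ i = y $ i}" "{..<k - 1}"] by simp
    then have "hamming_dist x y \<le> n - k + 1" using split[OF xy(1), of y] k by simp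
    then show ?thesis using xy by blast
  qed
  then have "n - k + 1 \<in> ?D" using lower by (smt (verit) le_antisym mem_Collect_eq)
  moreover have "finite ?D"
    using finite_subspace_vec[OF C]
    by (intro finite_subset[of ?D "(\<lambda>(x, y). hamming_dist x y) ` (C \<times> C)"]) auto
  ultimately have "min_distance C = n - k + 1"
    unfolding min_distance_def using lower by (intro Min_eqI) auto
  then show ?thesis
    unfolding MDS_code_def linear_code_def using C code_dim_eqI[OF C cC] by simp
qed

section \<open>Polynomial evaluation codes and GRS codes\<close>

lemma card_polys_degree_le:
  "card {f :: 'a::{finite,field} poly. degree f \<le> d} = CARD('a) ^ Suc d"
proof (induction d)
  case 0
  have "{f :: 'a poly. degree f \<le> 0} = (\<lambda>a. [:a:]) ` UNIV"
    by (auto elim: degree_eq_zeroE)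
  then show ?case by (simp add: card_image inj_on_def)
next
  case (Suc d)
  have "{f :: 'a poly. degree f \<le> Suc d} = (\<lambda>(a, f). pCons a f) ` (UNIV \<times> {f. degree f \<le> d})"
  proof (intro Set.set_eqI iffI)
    fix f :: "'a poly" assume f: "f \<in> {f. degree f \<le> Suc d}"
    show "f \<in> (\<lambda>(a, f). pCons a f) ` (UNIV \<times> {f. degree f \<le> d})"
    proof (cases f rule: pCons_cases)
      case (pCons a g)
      then have "degree g \<le> d" using f by (auto split: if_splits)
      then show ?thesis using pCons by auto
    qed
  qed (auto split: if_splits)
  moreover have "inj_on (\<lambda>(a, f). pCons a f) (UNIV \<times> {f :: 'a poly. degree f \<le> d})"
    by (auto simp: inj_on_def)
  ultimately show ?case using Suc by (simp add: card_image card_cartesian_product)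
qed

text \<open>The coordinates are arbitrary maps \<open>L j\<close> on polynomials, so that scaled
  evaluations and the coefficient read off at infinity fit one scheme.\<close>

definition eval_code :: "nat \<Rightarrow> nat \<Rightarrow> (nat \<Rightarrow> 'a::field poly \<Rightarrow> 'a) \<Rightarrow> 'a vec set" where
  "eval_code n d L = {vec n (\<lambda>j. L j f) | f. degree f \<le> d}"

text \<open>The bound on zeros is used twice: it limits the zeros of codewords and, because
  \<open>d < n\<close>, it makes encoding injective, so codewords are counted by
  polynomials.\<close>

lemma mds_eval_code:
  fixes L :: "nat \<Rightarrow> 'a::{finite,field} poly \<Rightarrow> 'a"
  assumes add: "\<And>j f g. j < n \<Longrightarrow> L j (f + g) = L j f + L j g"
    and smult: "\<And>j c f. j < n \<Longrightarrow> L j (Polynomial.smult c f) = c * L j f"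
    and zeros: "\<And>f. f \<noteq> 0 \<Longrightarrow> degree f \<le> d \<Longrightarrow> card {j. j < n \<and> L j f = 0} \<le> d"
    and d: "d < n"
  shows "mds n (Suc d) (eval_code n d L)"
proof -
  let ?w = "\<lambda>f. vec n (\<lambda>j. L j f)"
  have zero: "L j 0 = 0" if "j < n" for j using smult[OF that, of 0 0] by simp
  have w_add: "?w (f + g) = ?w f + ?w g" for f g using add by (intro eq_vecI) auto
  have w_smult: "?w (Polynomial.smult c f) = c \<cdot>\<^sub>v ?w f" for c f
    using smult by (intro eq_vecI) auto
  have w_zero: "?w 0 = 0\<^sub>v n" using zero by (intro eq_vecI) auto
  have S: "subspace_vec n (eval_code n d L)"
    unfolding subspace_vec_iff
  proof (intro conjI ballI allI)
    show "eval_code n d L \<subseteq> carrier_vec n" by (auto simp: eval_code_def)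
    show "0\<^sub>v n \<in> eval_code n d L"
      unfolding eval_code_def using w_zero by (auto intro!: exI[of _ 0])
    show "x + y \<in> eval_code n d L" if "x \<in> eval_code n d L" "y \<in> eval_code n d L" for x y
      using that w_add degree_add_le unfolding eval_code_def mem_Collect_eq by metis
    show "c \<cdot>\<^sub>v x \<in> eval_code n d L" if "x \<in> eval_code n d L" for c x
      using that w_smult degree_smult_le order_trans unfolding eval_code_def mem_Collect_eq by metis
  qed
  have f0: "f = 0" if "degree f \<le> d" "?w f = 0\<^sub>v n" for f
  proof (rule ccontr)
    assume "f \<noteq> 0"
    then have "card {j. j < n \<and> L j f = 0} \<le> d" using zeros that by blast
    moreover have "L j f = 0" if "j < n" for j
      using arg_cong[OF \<open>?w f = 0\<^sub>v n\<close>, of "\<lambda>x. x $ j"] that by simp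
    then have "{j. j < n \<and> L j f = 0} = {..<n}" by auto
    ultimately show False using d by simp
  qed
  have "inj_on ?w {f. degree f \<le> d}"
  proof (rule inj_onI)
    fix f g assume fg: "f \<in> {f. degree f \<le> d}" "g \<in> {f. degree f \<le> d}" "?w f = ?w g"
    have "?w (f + Polynomial.smult (-1) g) = 0\<^sub>v n"
      unfolding w_add w_smult using fg(3) by (intro eq_vecI) auto
    then have "f + Polynomial.smult (-1) g = 0"
      using fg by (intro f0) (auto intro: degree_diff_le)
    then show "f = g" by simp
  qed
  moreover have "eval_code n d L = ?w ` {f. degree f \<le> d}" by (auto simp: eval_code_def)
  ultimately have "card (eval_code n d L) = CARD('a) ^ Suc d"
    by (simp add: card_image card_polys_degree_le)
  moreover have "card {i. i < n \<and> x $ i = 0} < Suc d"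
    if x: "x \<in> eval_code n d L" "x \<noteq> 0\<^sub>v n" for x
  proof -
    obtain f where f: "x = ?w f" "degree f \<le> d" using x by (auto simp: eval_code_def)
    then have "f \<noteq> 0" using x(2) w_zero by auto
    then have "card {j. j < n \<and> L j f = 0} \<le> d" using zeros f by blast
    moreover have "{i. i < n \<and> x $ i = 0} = {j. j < n \<and> L j f = 0}" using f by auto
    ultimately show ?thesis by simp
  qed
  ultimately show ?thesis using S d by (simp add: mds_def)
qed

lemma card_roots_on_le:
  fixes a :: "nat \<Rightarrow> 'a::field"
  assumes "inj_on a {..<n}" "f \<noteq> 0"
  shows "card {j. j < n \<and> poly f (a j) = 0} \<le> degree f"
proof -
  have "card {j. j < n \<and> poly f (a j) = 0} = card (a ` {j. j < n \<and> poly f (a j) = 0})"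
    using assms(1) by (intro card_image[symmetric]) (auto simp: inj_on_def)
  also have "\<dots> \<le> card {x. poly f x = 0}"
    using assms(2) by (intro card_mono poly_roots_finite) auto
  also have "\<dots> \<le> degree f" using assms(2) by (rule card_poly_roots_bound)
  finally show ?thesis .
qed

lemma GRS_eq_eval_code: "GRS n k a v = eval_code n (k - 1) (\<lambda>j f. v j * poly f (a j))"
  by (simp add: GRS_def eval_code_def)

text \<open>Since the multipliers are nonzero and the points distinct, zeros of a codeword
  correspond to distinct roots of a polynomial of degree at most \<open>k - 1\<close>.\<close>

lemma GRS_code_mds:
  fixes C :: "'a::{finite,field} vec set"
  assumes "GRS_code n k C"
  shows "mds n k C"
proof -
  obtain a v where k: "1 \<le> k" "k \<le> n" and a: "inj_on a {..<n}" and v: "\<forall>j<n. v j \<noteq> 0"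
    and C: "C = GRS n k a v" using assms by (auto simp: GRS_code_def)
  have "mds n (Suc (k - 1)) (eval_code n (k - 1) (\<lambda>j f. v j * poly f (a j)))"
  proof (rule mds_eval_code)
    fix f :: "'a poly" assume f: "f \<noteq> 0" "degree f \<le> k - 1"
    have "{j. j < n \<and> v j * poly f (a j) = 0} = {j. j < n \<and> poly f (a j) = 0}"
      using v by auto
    then show "card {j. j < n \<and> v j * poly f (a j) = 0} \<le> k - 1"
      using card_roots_on_le[OF a f(1)] f(2) by simp
  qed (use k in \<open>auto simp: algebra_simps\<close>)
  then show ?thesis using C k by (simp add: GRS_eq_eval_code)
qed

text \<open>The extra coordinate is evaluation at the point at infinity.\<close>
lemma extended_GRS_mds:
  fixes a v :: "nat \<Rightarrow> 'a::{finite,field}"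
  assumes a: "inj_on a {..<n}" and v: "\<forall>j<n. v j \<noteq> 0" and k: "k \<le> n"
  shows "mds (Suc n) (Suc k)
    (eval_code (Suc n) k (\<lambda>j f. if j < n then v j * poly f (a j) else coeff f k))"
proof (rule mds_eval_code)
  fix f :: "'a poly" assume f: "f \<noteq> 0" "degree f \<le> k"
  let ?Z = "{j. j < Suc n \<and> (if j < n then v j * poly f (a j) else coeff f k) = 0}"
  let ?R = "{j. j < n \<and> poly f (a j) = 0}"
  have R: "card ?R \<le> degree f" by (rule card_roots_on_le[OF a f(1)])
  show "card ?Z \<le> k"
  proof (cases "coeff f k = 0")
    case True
    \<comment> \<open>A zero at infinity means that the degree drops, so the additional zero is paid
      for by one root fewer.\<close>
    then have "degree f < k" using f by (metis le_neq_implies_less leading_coeff_0_iff)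
    moreover have "card ?Z \<le> card (insert n ?R)"
      using v by (intro card_mono) (auto simp: less_Suc_eq split: if_splits)
    moreover have "\<dots> \<le> Suc (card ?R)" by (rule card_insert_le_m1) auto
    ultimately show ?thesis using R by simp
  next
    case False
    then have "?Z \<subseteq> ?R" using v by (auto simp: less_Suc_eq split: if_splits)
    then have "card ?Z \<le> card ?R" by (intro card_mono) auto
    then show ?thesis using R f by simp
  qed
qed (use k in \<open>auto simp: algebra_simps\<close>)


section \<open>Scaling a single coordinate\<close>

definition scale_coord :: "nat \<Rightarrow> 'a::field \<Rightarrow> 'a vec \<Rightarrow> 'a vec" where
  "scale_coord j c x = vec (dim_vec x) (\<lambda>i. if i = j then c * x $ i else x $ i)"

text \<open>Scaling by a nonzero \<open>c\<close> is linear, invertible and leaves the zero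
  positions of each word unchanged.\<close>

lemma mds_scale_coord:
  fixes C :: "'a::{finite,field} vec set"
  assumes "mds n k C" "c \<noteq> 0"
  shows "mds n k (scale_coord j c ` C)"
proof -
  have C: "subspace_vec n C" and zeros: "\<And>x. x \<in> C \<Longrightarrow> x \<noteq> 0\<^sub>v n \<Longrightarrow> card {i. i < n \<and> x $ i = 0} < k"
    using assms unfolding mds_def by auto
  note D = subspace_vecD[OF C]
  let ?s = "scale_coord j c"
  have car: "x \<in> carrier_vec n" if "x \<in> C" for x using that D(1) by auto
  have s_add: "?s (x + y) = ?s x + ?s y" if "x \<in> C" "y \<in> C" for x y
    using car[OF that(1)] car[OF that(2)]
    by (intro eq_vecI) (auto simp: scale_coord_def algebra_simps)
  have s_smult: "?s (b \<cdot>\<^sub>v x) = b \<cdot>\<^sub>v ?s x" for b x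
    by (intro eq_vecI) (auto simp: scale_coord_def)
  have s_zero: "?s (0\<^sub>v n) = 0\<^sub>v n" by (intro eq_vecI) (auto simp: scale_coord_def)
  have "subspace_vec n (?s ` C)"
    unfolding subspace_vec_iff
  proof (intro conjI ballI allI)
    show "?s ` C \<subseteq> carrier_vec n" using D(1) by (auto simp: scale_coord_def)
    show "0\<^sub>v n \<in> ?s ` C" using s_zero D(2) by (metis imageI)
    show "x + y \<in> ?s ` C" if "x \<in> ?s ` C" "y \<in> ?s ` C" for x y
      using that by (auto simp: s_add[symmetric] D(3))
    show "b \<cdot>\<^sub>v x \<in> ?s ` C" if "x \<in> ?s ` C" for b x
      using that by (auto simp: s_smult[symmetric] D(4))
  qed
  moreover have "?s (scale_coord j (inverse c) x) = x"
    "scale_coord j (inverse c) (?s x) = x" for x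
    using assms(2) by (auto intro!: eq_vecI simp: scale_coord_def)
  then have "inj_on ?s C" by (metis inj_on_inverseI)
  then have "card (?s ` C) = card C" by (rule card_image)
  moreover have "card {i. i < n \<and> x $ i = 0} < k" if "x \<in> ?s ` C" "x \<noteq> 0\<^sub>v n" for x
  proof -
    obtain y where y: "x = ?s y" "y \<in> C" using \<open>x \<in> ?s ` C\<close> by auto
    have "y \<noteq> 0\<^sub>v n" using that y s_zero by auto
    moreover have "{i. i < n \<and> x $ i = 0} = {i. i < n \<and> y $ i = 0}"
      using y car[OF y(2)] assms(2) by (auto simp: scale_coord_def split: if_splits)
    ultimately show ?thesis using zeros y(2) by simp
  qed
  ultimately show ?thesis using assms(1) unfolding mds_def by simp
qed

section \<open>The Hermitian form and the hull\<close>

text \<open>The \<open>q\<close>-th power sits on the second argument, as in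
  \<open>hermitian_dual\<close>, which makes the form linear in the first.\<close>

definition herm :: "nat \<Rightarrow> nat \<Rightarrow> 'a::field vec \<Rightarrow> 'a vec \<Rightarrow> 'a" where
  "herm q n y x = (\<Sum>i<n. y $ i * (x $ i) ^ q)"

lemma herm_add_left:
  assumes "x \<in> carrier_vec n" "y \<in> carrier_vec n"
  shows "herm q n (x + y) z = herm q n x z + herm q n y z"
  using assms by (simp add: herm_def algebra_simps sum.distrib)

lemma herm_smult_left:
  assumes "x \<in> carrier_vec n"
  shows "herm q n (c \<cdot>\<^sub>v x) z = c * herm q n x z"
  using assms by (simp add: herm_def algebra_simps sum_distrib_left)

lemma herm_scale_coord:
  assumes "x \<in> carrier_vec n" "y \<in> carrier_vec n" "j < n"
  shows "herm q n (scale_coord j c y) (scale_coord j c x) =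
    herm q n y x + (c ^ (q + 1) - 1) * (y $ j * (x $ j) ^ q)"
proof -
  have "herm q n (scale_coord j c y) (scale_coord j c x) =
      c * y $ j * (c * x $ j) ^ q + (\<Sum>i\<in>{..<n} - {j}. y $ i * (x $ i) ^ q)"
    unfolding herm_def using assms
    by (subst sum.remove[of _ j]) (auto simp: scale_coord_def intro!: sum.cong)
  moreover have "herm q n y x =
      y $ j * (x $ j) ^ q + (\<Sum>i\<in>{..<n} - {j}. y $ i * (x $ i) ^ q)"
    unfolding herm_def using assms by (subst sum.remove[of _ j]) auto
  ultimately show ?thesis by (simp add: algebra_simps power_mult_distrib)
qed

lemma mem_hermitian_hull_iff:
  assumes "subspace_vec n C"
  shows "x \<in> hermitian_hull q n C \<longleftrightarrow> x \<in> C \<and> (\<forall>y\<in>C. herm q n y x = 0)"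
  using subspace_vecD(1)[OF assms] by (auto simp: hermitian_hull_def hermitian_dual_def herm_def)

locale hermitian_field =
  fixes q :: nat and field_type :: "'a::{finite,field} itself"
  assumes primepow_q: "primepow q" and q_gt_2: "q > 2" and card_field: "CARD('a) = q ^ 2"
begin

text \<open>Translation by \<open>1\<close> permutes the field, so summing all elements shows that
  \<open>q ^ 2\<close> is zero in it. The characteristic is therefore the prime under
  \<open>q\<close>, and the \<open>q\<close>-th power map is additive.\<close>

lemma q_power_CHAR: "prime CHAR('a)" "\<exists>k. q = CHAR('a) ^ k"
proof -
  show CHAR: "prime CHAR('a)"
    using finite_imp_CHAR_pos[where 'a = 'a] prime_CHAR_semidom[where 'a = 'a] by simp
  obtain p k where p: "prime p" "q = p ^ k"
    using primepow_q by (auto simp: primepow_def)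
  have "(\<Sum>x\<in>(UNIV :: 'a set). x + 1) = (\<Sum>x\<in>UNIV. x)"
    by (rule sum.reindex_bij_witness[of _ "\<lambda>x. x - 1" "\<lambda>x. x + 1"]) auto
  then have "of_nat CARD('a) = (0 :: 'a)" by (simp add: sum.distrib)
  then have "CHAR('a) dvd (p ^ k) ^ 2"
    by (simp only: of_nat_eq_0_iff_char_dvd card_field p(2))
  then have "CHAR('a) dvd p" using CHAR prime_dvd_power by blast
  then have "CHAR('a) = p" using CHAR p(1) primes_dvd_imp_eq by blast
  then show "\<exists>k. q = CHAR('a) ^ k" using p by blast
qed

lemma conj_add: "(x + y :: 'a) ^ q = x ^ q + y ^ q"
  using q_power_CHAR freshmans_dream' by blast

lemma conj_sum: "(\<Sum>i\<in>A. f i :: 'a) ^ q = (\<Sum>i\<in>A. f i ^ q)"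
  using q_power_CHAR freshmans_dream_sum' by blast

text \<open>Multiplication by a nonzero \<open>x\<close> permutes the nonzero elements; comparing
  their products gives exponent \<open>q ^ 2 - 1\<close>.\<close>

lemma conj_conj: "((x :: 'a) ^ q) ^ q = x"
proof (cases "x = 0")
  case False
  have "(\<Prod>y\<in>-{0}. x * y) = (\<Prod>y\<in>-{0}. y)"
    by (rule prod.reindex_bij_witness[of _ "\<lambda>y. y / x" "\<lambda>y. x * y"]) (use False in auto)
  then have "x ^ card (- {0 :: 'a}) = 1"
    by (simp add: prod.distrib)
  moreover have "Suc (card (- {0 :: 'a})) = q ^ 2"
    using q_gt_2 by (simp add: Compl_eq_Diff_UNIV card_Diff_singleton card_field)
  ultimately have "x ^ (q ^ 2) = x" by (metis mult.right_neutral power_Suc)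
  then show ?thesis by (simp add: power2_eq_square power_mult)
qed (use q_gt_2 in auto)

lemma herm_conj: "herm q n y (x :: 'a vec) ^ q = herm q n x y"
  by (simp add: herm_def conj_sum power_mult_distrib conj_conj mult.commute)

lemma herm_eq_0_commute: "herm q n y (x :: 'a vec) = 0 \<longleftrightarrow> herm q n x y = 0"
  using herm_conj[of n x y] herm_conj[of n y x] q_gt_2 by auto

text \<open>Conjugate symmetry moves the candidate word into the linear argument, from which closure
  of the hull under addition and scaling follows directly.\<close>

lemma mem_hull_iff:
  fixes C :: "'a vec set"
  assumes "subspace_vec n C"
  shows "x \<in> hermitian_hull q n C \<longleftrightarrow> x \<in> C \<and> (\<forall>y\<in>C. herm q n x y = 0)"
  by (simp add: mem_hermitian_hull_iff[OF assms] herm_eq_0_commute)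

lemma subspace_hermitian_hull:
  fixes C :: "'a vec set"
  assumes "subspace_vec n C"
  shows "subspace_vec n (hermitian_hull q n C)"
proof -
  note D = subspace_vecD[OF assms]
  have car: "x \<in> carrier_vec n" if "x \<in> C" for x using that D(1) by auto
  show ?thesis
    unfolding subspace_vec_iff mem_hull_iff[OF assms]
    using D by (auto simp: mem_hull_iff[OF assms] herm_add_left herm_smult_left car)
      (simp add: herm_def)
qed

section \<open>Reducing the hull dimension\<close>

text \<open>Otherwise all \<open>q ^ 2 - 1\<close> nonzero elements would be roots of a polynomial
  of degree at most \<open>q + 1\<close>, which is impossible for \<open>q > 2\<close>. For
  \<open>q = 2\<close> every nonzero element does have norm \<open>1\<close>.\<close>

lemma exists_norm_ne_1: "\<exists>c :: 'a. c \<noteq> 0 \<and> c ^ (q + 1) \<noteq> 1"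
proof (rule ccontr)
  let ?p = "monom 1 (q + 1) - 1 :: 'a poly"
  assume "\<nexists>c :: 'a. c \<noteq> 0 \<and> c ^ (q + 1) \<noteq> 1"
  then have "- {0 :: 'a} \<subseteq> {c. poly ?p c = 0}" by (auto simp: poly_monom)
  moreover have "coeff ?p (q + 1) = 1" by simp
  then have p: "?p \<noteq> 0" by (metis coeff_0 zero_neq_one)
  ultimately have "card (- {0 :: 'a}) \<le> card {c. poly ?p c = 0}"
    by (intro card_mono poly_roots_finite) auto
  also have "\<dots> \<le> degree ?p" using p by (rule card_poly_roots_bound)
  also have "\<dots> \<le> q + 1" by (intro degree_diff_le) (auto simp: degree_monom_le)
  finally have "q * q \<le> q + 2" by (simp add: Compl_eq_Diff_UNIV card_Diff_singleton card_field power2_eq_square)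
  moreover have "3 * q \<le> q * q" using q_gt_2 by simp
  ultimately show False using q_gt_2 by simp
qed

text \<open>Scaling coordinate \<open>j\<close> by \<open>c\<close> adds \<open>(c ^ (q + 1) - 1) * (y $ j * (x $ j) ^ q)\<close> to the
  Hermitian form. Testing against a hull word that is nonzero at \<open>j\<close> forces every word of the new
  hull to vanish at \<open>j\<close>.\<close>
lemma hull_scale_coord:
  fixes C :: "'a vec set"
  assumes C: "subspace_vec n C" "subspace_vec n (scale_coord j c ` C)" and c: "c ^ (q + 1) \<noteq> 1"
    and h: "h \<in> hermitian_hull q n C" "j < n" "h $ j \<noteq> 0"
  shows "hermitian_hull q n (scale_coord j c ` C) = {x \<in> hermitian_hull q n C. x $ j = 0}"
proof -
  have car: "x \<in> carrier_vec n" if "x \<in> C" for x using that subspace_vecD(1)[OF C(1)] by auto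
  have fixed: "scale_coord j c x = x" if "x $ j = 0" for x
    using that by (intro eq_vecI) (auto simp: scale_coord_def)
  note form = herm_scale_coord[OF car car h(2), of _ _ q c]
  have hC: "h \<in> C" "\<And>x. x \<in> C \<Longrightarrow> herm q n h x = 0"
    using h(1) mem_hull_iff[OF C(1)] by auto
  show ?thesis
  proof (intro Set.set_eqI iffI)
    fix z assume "z \<in> hermitian_hull q n (scale_coord j c ` C)"
    then obtain x where x: "x \<in> C" "z = scale_coord j c x"
      and orth: "\<And>y. y \<in> C \<Longrightarrow> herm q n (scale_coord j c y) (scale_coord j c x) = 0"
      by (auto simp: mem_hermitian_hull_iff[OF C(2)])
    have "x $ j = 0"
      using orth[OF hC(1)] form[OF x(1) hC(1)] hC(2)[OF x(1)] c h(3) by auto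
    moreover have "herm q n y x = 0" if "y \<in> C" for y
      using orth[OF that] form[OF x(1) that] \<open>x $ j = 0\<close> q_gt_2 by (simp add: power_0_left)
    ultimately show "z \<in> {x \<in> hermitian_hull q n C. x $ j = 0}"
      using x fixed by (simp add: mem_hermitian_hull_iff[OF C(1)])
  \<comment> \<open>Conversely, a word vanishing at \<open>j\<close> is fixed by the scaling, and
    the correction to the form is zero.\<close>
  next
    fix x assume "x \<in> {x \<in> hermitian_hull q n C. x $ j = 0}"
    then have x: "x \<in> C" "x $ j = 0" and orth: "\<And>y. y \<in> C \<Longrightarrow> herm q n y x = 0"
      by (auto simp: mem_hermitian_hull_iff[OF C(1)])
    have "herm q n (scale_coord j c y) x = 0" if "y \<in> C" for y
      using form[OF x(1) that] orth[OF that] x(2) fixed[OF x(2)] q_gt_2 by simp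
    then show "x \<in> hermitian_hull q n (scale_coord j c ` C)"
      using x fixed[OF x(2)] by (auto simp: mem_hermitian_hull_iff[OF C(2)] intro: rev_image_eqI)
  qed
qed

text \<open>The hull contains a nonzero word, hence some coordinate does not vanish on it. Scaling
  there replaces the hull by the kernel of that coordinate functional, which has codimension
  one.\<close>

lemma mds_hull_reduce_step:
  fixes C :: "'a vec set"
  assumes "mds n k C" "card (hermitian_hull q n C) = CARD('a) ^ Suc d"
  shows "\<exists>C' :: 'a vec set. mds n k C' \<and> card (hermitian_hull q n C') = CARD('a) ^ d"
proof -
  let ?H = "hermitian_hull q n C"
  have C: "subspace_vec n C" using assms(1) by (simp add: mds_def)
  note H = subspace_hermitian_hull[OF C]
  have "\<not> ?H \<subseteq> {0\<^sub>v n}"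
  proof
    assume "?H \<subseteq> {0\<^sub>v n}"
    then have "card ?H \<le> 1" using card_mono[of "{0\<^sub>v n}" ?H] by simp
    moreover have "1 < CARD('a) ^ Suc d" using one_less_CARD[where 'a = 'a] by (rule one_less_power) simp
    ultimately show False using assms(2) by simp
  qed
  then obtain h where h: "h \<in> ?H" "h \<noteq> 0\<^sub>v n" by blast
  have car: "x \<in> carrier_vec n" if "x \<in> ?H" for x using that subspace_vecD(1)[OF H] by auto
  obtain j where j: "j < n" "h $ j \<noteq> 0"
    using h(2) car[OF h(1)] by (metis carrier_vecD eq_vecI index_zero_vec)
  obtain c :: 'a where c: "c \<noteq> 0" "c ^ (q + 1) \<noteq> 1" using exists_norm_ne_1 by blast
  have C': "mds n k (scale_coord j c ` C)" using mds_scale_coord[OF assms(1) c(1)] .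
  have "card ?H = CARD('a) * card {x \<in> ?H. x $ j = 0}"
  proof (rule card_functional_kernel[OF H])
    show "(x + y) $ j = x $ j + y $ j" if "x \<in> ?H" "y \<in> ?H" for x y
      using car[OF that(2)] j(1) by simp
    show "(b \<cdot>\<^sub>v x) $ j = b * x $ j" if "x \<in> ?H" for b x
      using car[OF that] j(1) by simp
  qed (use h j in auto)
  moreover have "hermitian_hull q n (scale_coord j c ` C) = {x \<in> ?H. x $ j = 0}"
    using C' by (intro hull_scale_coord[OF C _ c(2) h(1) j]) (simp add: mds_def)
  ultimately have "card (hermitian_hull q n (scale_coord j c ` C)) = CARD('a) ^ d"
    using assms(2) by simp
  then show ?thesis using C' by blast
qed

lemma mds_hull_reduce:
  fixes C :: "'a vec set"
  assumes "mds n k C" "card (hermitian_hull q n C) = CARD('a) ^ (s + t)"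
  shows "\<exists>C' :: 'a vec set. mds n k C' \<and> card (hermitian_hull q n C') = CARD('a) ^ s"
  using assms
proof (induction t arbitrary: C)
  case (Suc t)
  then show ?case using mds_hull_reduce_step[of n k C "s + t"] by (metis add_Suc_right)
qed auto

section \<open>Extending the code while controlling its hull\<close>

text \<open>A hull word of \<open>C\<close> orthogonal to \<open>u\<close> stays in the hull after appending \<open>0\<close>.\<close>
lemma card_hull_extend:
  fixes C C' :: "'a vec set"
  assumes C: "subspace_vec n C" and C': "subspace_vec (Suc n) C'"
    and decomp: "\<And>y. y \<in> C' \<Longrightarrow> \<exists>x\<in>C. \<exists>b. \<forall>j<n. y $ j = x $ j + b * u j"
    and embed: "\<And>x. x \<in> C \<Longrightarrow> vec (Suc n) (\<lambda>j. if j < n then x $ j else 0) \<in> C'"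
  shows "card (hermitian_hull q n C) \<le> CARD('a) * card (hermitian_hull q (Suc n) C')"
proof -
  let ?H = "hermitian_hull q n C"
  let ?K = "{x \<in> ?H. herm q n x (vec n u) = 0}"
  let ?e = "\<lambda>x. vec (Suc n) (\<lambda>j. if j < n then x $ j else 0)"
  note H = subspace_hermitian_hull[OF C]
  have car: "x \<in> carrier_vec n" if "x \<in> ?H" for x using that subspace_vecD(1)[OF H] by auto
  \<comment> \<open>Pairing with \<open>u\<close> is a linear functional on the hull: its kernel has
    index \<open>CARD('a)\<close>, or is everything if the functional is zero.\<close>
  have "card ?H \<le> CARD('a) * card ?K"
  proof (cases "\<exists>h\<in>?H. herm q n h (vec n u) \<noteq> 0")
    case True
    then obtain h where "h \<in> ?H" "herm q n h (vec n u) \<noteq> 0" by blast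
    then show ?thesis
      using card_functional_kernel[OF H, of "\<lambda>x. herm q n x (vec n u)" h]
      by (simp add: herm_add_left herm_smult_left car)
  next
    case False
    then have "?K = ?H" by auto
    then show ?thesis by simp
  qed
  also have "card ?K \<le> card (hermitian_hull q (Suc n) C')"
  proof (rule card_inj_on_le)
    show "inj_on ?e ?K"
    proof (rule inj_onI)
      fix x y assume xy: "x \<in> ?K" "y \<in> ?K" "?e x = ?e y"
      have "x $ j = y $ j" if "j < n" for j
        using arg_cong[OF xy(3), of "\<lambda>z. z $ j"] that by simp
      then show "x = y" using xy car by (metis (no_types, lifting) carrier_vecD eq_vecI mem_Collect_eq)
    qed
    show "?e ` ?K \<subseteq> hermitian_hull q (Suc n) C'"
    proof (rule image_subsetI)
      fix x assume x: "x \<in> ?K"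
      then have xC: "x \<in> C" and orth: "\<And>y. y \<in> C \<Longrightarrow> herm q n y x = 0"
        by (auto simp: mem_hermitian_hull_iff[OF C])
      have u0: "herm q n (vec n u) x = 0" using x herm_eq_0_commute by blast
      have "herm q (Suc n) y (?e x) = 0" if y: "y \<in> C'" for y
      proof -
        obtain z b where z: "z \<in> C" "\<And>j. j < n \<Longrightarrow> y $ j = z $ j + b * u j"
          using decomp[OF y] by blast
        \<comment> \<open>The padded coordinate contributes nothing, since
          \<open>0 ^ q = 0\<close>.\<close>
        have "herm q (Suc n) y (?e x) = (\<Sum>j<n. y $ j * (x $ j) ^ q)"
          using q_gt_2 by (simp add: herm_def)
        also have "\<dots> = herm q n z x + b * herm q n (vec n u) x"
          unfolding herm_def sum_distrib_left sum.distrib[symmetric]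
          by (intro sum.cong) (auto simp: z(2) algebra_simps)
        finally show ?thesis using orth[OF z(1)] u0 by simp
      qed
      then show "?e x \<in> hermitian_hull q (Suc n) C'"
        using embed[OF xC] by (simp add: mem_hermitian_hull_iff[OF C'])
    qed
    show "finite (hermitian_hull q (Suc n) C')"
      using finite_subspace_vec subspace_hermitian_hull[OF C'] by blast
  qed
  finally show ?thesis by simp
qed

text \<open>With \<open>v' j = v j / (a j - b)\<close>, the words of the longer code that vanish at the new point \<open>b\<close>
  come from \<open>f = (x - b) g\<close> and restrict to the original code.\<close>
lemma GRS_extend:
  fixes C :: "'a vec set"
  assumes "GRS_code n k C" "n < CARD('a)"
  shows "\<exists>C' :: 'a vec set. GRS_code (Suc n) (Suc k) C' \<and>
    card (hermitian_hull q n C) \<le> CARD('a) * card (hermitian_hull q (Suc n) C')"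
proof -
  obtain a v where k: "1 \<le> k" "k \<le> n" and a: "inj_on a {..<n}" and v: "\<forall>j<n. v j \<noteq> 0"
    and C: "C = GRS n k a v" using assms(1) by (auto simp: GRS_code_def)
  have "card (a ` {..<n}) < CARD('a)" using card_image_le[of "{..<n}" a] assms(2) by simp
  then have "a ` {..<n} \<noteq> UNIV" by auto
  then obtain b where b: "b \<notin> a ` {..<n}" by auto
  then have ab: "a j - b \<noteq> 0" if "j < n" for j using that by auto
  define a' where "a' = a(n := b)"
  define v' where "v' = (\<lambda>j. if j < n then v j / (a j - b) else 1)"
  have G: "GRS_code (Suc n) (Suc k) (GRS (Suc n) (Suc k) a' v')"
    unfolding GRS_code_def
  proof (intro conjI exI allI impI)
    show "inj_on a' {..<Suc n}"
      using a b by (auto simp: inj_on_def a'_def less_Suc_eq)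
    show "v' j \<noteq> 0" if "j < Suc n" for j
      using that v ab by (auto simp: v'_def)
  qed (use k in auto)
  have "card (hermitian_hull q n C) \<le> CARD('a) * card (hermitian_hull q (Suc n) (GRS (Suc n) (Suc k) a' v'))"
  proof (rule card_hull_extend[where u = v'])
    show "subspace_vec n C" "subspace_vec (Suc n) (GRS (Suc n) (Suc k) a' v')"
      using GRS_code_mds[OF assms(1)] GRS_code_mds[OF G] by (auto simp: mds_def)
  next
    fix y assume "y \<in> GRS (Suc n) (Suc k) a' v'"
    then obtain f where f: "y = vec (Suc n) (\<lambda>j. v' j * poly f (a' j))" "degree f \<le> k"
      by (auto simp: GRS_def)
    \<comment> \<open>Division by the linear factor at \<open>b\<close>: the quotient yields a word
      of \<open>C\<close>, and the remainder \<open>poly f b\<close> is the multiple of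
      \<open>u\<close> required by \<open>decomp\<close>.\<close>
    define g where "g = synthetic_div f b"
    have f_split: "poly f x = (x - b) * poly g x + poly f b" for x
      using arg_cong[OF synthetic_div_correct'[of b f], of "\<lambda>p. poly p x"]
      by (simp add: g_def algebra_simps)
    have "degree g \<le> k - 1" using f(2) by (simp add: g_def degree_synthetic_div)
    then have "vec n (\<lambda>j. v j * poly g (a j)) \<in> C" by (auto simp: C GRS_def)
    moreover have "y $ j = v j * poly g (a j) + poly f b * v' j" if "j < n" for j
    proof -
      have "y $ j = v j / (a j - b) * poly f (a j)"
        using that f(1) by (simp add: a'_def v'_def)
      also have "\<dots> = v j / (a j - b) * ((a j - b) * poly g (a j) + poly f b)"
        by (subst f_split) (rule refl)
      finally show ?thesis using that ab[OF that] by (simp add: v'_def distrib_left)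
    qed
    ultimately show "\<exists>x\<in>C. \<exists>b. \<forall>j<n. y $ j = x $ j + b * v' j"
      by (intro bexI[of _ "vec n (\<lambda>j. v j * poly g (a j))"] exI[of _ "poly f b"]) auto
  next
    fix x assume "x \<in> C"
    then obtain g where g: "x = vec n (\<lambda>j. v j * poly g (a j))" "degree g \<le> k - 1"
      by (auto simp: C GRS_def)
    \<comment> \<open>The new factor forces a zero at \<open>b\<close> and cancels the denominator
      in \<open>v'\<close> at the old points.\<close>
    define f where "f = [:- b, 1:] * g"
    have "degree f \<le> k" using degree_mult_le[of "[:- b, 1:]" g] g(2) k by (simp add: f_def)
    moreover have "vec (Suc n) (\<lambda>j. if j < n then x $ j else 0) =
        vec (Suc n) (\<lambda>j. v' j * poly f (a' j))"
    proof (rule eq_vecI)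
      have "poly f z = (z - b) * poly g z" for z by (simp add: f_def algebra_simps)
      then have "v' j * poly f (a' j) = (if j < n then v j * poly g (a j) else 0)"
        if "j < Suc n" for j
        using that ab[of j] by (auto simp: v'_def a'_def less_Suc_eq)
      then show "vec (Suc n) (\<lambda>j. if j < n then x $ j else 0) $ j =
          vec (Suc n) (\<lambda>j. v' j * poly f (a' j)) $ j"
        if "j < dim_vec (vec (Suc n) (\<lambda>j. v' j * poly f (a' j)))" for j
        using that by (simp add: g)
    qed simp
    ultimately show "vec (Suc n) (\<lambda>j. if j < n then x $ j else 0) \<in> GRS (Suc n) (Suc k) a' v'"
      by (auto simp: GRS_def)
  qed
  then show ?thesis using G by blast
qed

lemma GRS_extend_infinity:
  fixes C :: "'a vec set"
  assumes "GRS_code n k C"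
  shows "\<exists>C' :: 'a vec set. mds (Suc n) (Suc k) C' \<and>
    card (hermitian_hull q n C) \<le> CARD('a) * card (hermitian_hull q (Suc n) C')"
proof -
  obtain a v where k: "1 \<le> k" "k \<le> n" and a: "inj_on a {..<n}" and v: "\<forall>j<n. v j \<noteq> 0"
    and C: "C = GRS n k a v" using assms(1) by (auto simp: GRS_code_def)
  let ?L = "\<lambda>j f. if j < n then v j * poly f (a j) else coeff f k"
  have M: "mds (Suc n) (Suc k) (eval_code (Suc n) k ?L)"
    using extended_GRS_mds[OF a v k(2)] .
  have "card (hermitian_hull q n C) \<le> CARD('a) * card (hermitian_hull q (Suc n) (eval_code (Suc n) k ?L))"
  proof (rule card_hull_extend[where u = "\<lambda>j. v j * a j ^ k"])
    show "subspace_vec n C" "subspace_vec (Suc n) (eval_code (Suc n) k ?L)"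
      using GRS_code_mds[OF assms(1)] M by (auto simp: mds_def)
  next
    fix y assume "y \<in> eval_code (Suc n) k ?L"
    then obtain f where f: "y = vec (Suc n) (\<lambda>j. ?L j f)" "degree f \<le> k"
      by (auto simp: eval_code_def)
    define g where "g = f - monom (coeff f k) k"
    have "degree g \<le> k" unfolding g_def using f(2)
      by (intro degree_diff_le) (auto intro: degree_monom_le)
    moreover have "coeff g k = 0" by (simp add: g_def)
    \<comment> \<open>Degree exactly \<open>k\<close> would make the leading coefficient zero, hence
      \<open>g = 0\<close>, contradicting \<open>1 \<le> k\<close>.\<close>
    ultimately have "degree g \<le> k - 1"
      using k(1) by (cases "degree g = k") (auto dest: leading_coeff_0_iff[THEN iffD1])
    then have "vec n (\<lambda>j. v j * poly g (a j)) \<in> C" by (auto simp: C GRS_def)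
    moreover have "y $ j = v j * poly g (a j) + coeff f k * (v j * a j ^ k)" if "j < n" for j
      using that f(1) by (simp add: g_def poly_monom algebra_simps)
    ultimately show "\<exists>x\<in>C. \<exists>b. \<forall>j<n. y $ j = x $ j + b * (v j * a j ^ k)"
      by (intro bexI[of _ "vec n (\<lambda>j. v j * poly g (a j))"] exI[of _ "coeff f k"]) auto
  next
    fix x assume "x \<in> C"
    then obtain g where g: "x = vec n (\<lambda>j. v j * poly g (a j))" "degree g \<le> k - 1"
      by (auto simp: C GRS_def)
    have "coeff g k = 0" using g(2) k by (intro coeff_eq_0) simp
    then have "vec (Suc n) (\<lambda>j. if j < n then x $ j else 0) = vec (Suc n) (\<lambda>j. ?L j g)"
      by (intro eq_vecI) (auto simp: g)
    moreover have "degree g \<le> k" using g(2) by simp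
    ultimately show "vec (Suc n) (\<lambda>j. if j < n then x $ j else 0) \<in> eval_code (Suc n) k ?L"
      by (auto simp: eval_code_def)
  qed
  then show ?thesis using M by blast
qed

text \<open>Extension at a finite point yields a GRS code again, so it can be repeated until the
  field elements run out; each round costs at most a factor \<open>CARD('a)\<close>.\<close>

lemma GRS_extend_iterate:
  fixes C :: "'a vec set"
  assumes "GRS_code n k C" "n + i \<le> CARD('a)"
  shows "\<exists>C' :: 'a vec set. GRS_code (n + i) (k + i) C' \<and>
    card (hermitian_hull q n C) \<le> CARD('a) ^ i * card (hermitian_hull q (n + i) C')"
  using assms
proof (induction i)
  case (Suc i)
  then obtain C1 :: "'a vec set" where C1: "GRS_code (n + i) (k + i) C1"
    "card (hermitian_hull q n C) \<le> CARD('a) ^ i * card (hermitian_hull q (n + i) C1)" by auto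
  obtain C2 :: "'a vec set" where C2: "GRS_code (Suc (n + i)) (Suc (k + i)) C2"
    "card (hermitian_hull q (n + i) C1) \<le> CARD('a) * card (hermitian_hull q (Suc (n + i)) C2)"
    using GRS_extend[OF C1(1)] Suc.prems by auto
  have "CARD('a) ^ i * card (hermitian_hull q (n + i) C1) \<le>
      CARD('a) ^ i * (CARD('a) * card (hermitian_hull q (Suc (n + i)) C2))"
    using C2(2) by (rule mult_le_mono2)
  then show ?case using order_trans[OF C1(2)] C2(1) by (intro exI[of _ C2]) (simp add: mult_ac)
qed auto

text \<open>The first \<open>i - 1\<close> new points are finite and the last is at infinity, which
  gains one unit of length; accordingly the result is claimed to be MDS rather than GRS.\<close>

lemma mds_extension_exists:
  fixes C :: "'a vec set"
  assumes "GRS_code n k C" "1 \<le> i" "n + i \<le> CARD('a) + 1"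
  shows "\<exists>C' :: 'a vec set. mds (n + i) (k + i) C' \<and>
    card (hermitian_hull q n C) \<le> CARD('a) ^ i * card (hermitian_hull q (n + i) C')"
proof -
  obtain m where m: "i = Suc m" using assms(2) by (cases i) auto
  obtain C1 :: "'a vec set" where C1: "GRS_code (n + m) (k + m) C1"
    "card (hermitian_hull q n C) \<le> CARD('a) ^ m * card (hermitian_hull q (n + m) C1)"
    using GRS_extend_iterate[OF assms(1), of m] assms(3) m by auto
  obtain C2 :: "'a vec set" where C2: "mds (Suc (n + m)) (Suc (k + m)) C2"
    "card (hermitian_hull q (n + m) C1) \<le> CARD('a) * card (hermitian_hull q (Suc (n + m)) C2)"
    using GRS_extend_infinity[OF C1(1)] by auto
  have "CARD('a) ^ m * card (hermitian_hull q (n + m) C1) \<le>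
      CARD('a) ^ m * (CARD('a) * card (hermitian_hull q (Suc (n + m)) C2))"
    using C2(2) by (rule mult_le_mono2)
  then show ?thesis using order_trans[OF C1(2)] C2(1) m by (intro exI[of _ C2]) (simp add: mult_ac)
qed

end

section \<open>Extension followed by reduction to the prescribed hull dimension\<close>

theorem corollary8:
  fixes q n k l i s :: nat
  assumes "primepow q" and "q > 2"
    and "card (UNIV :: 'a::{finite,field} set) = q ^ 2"
    and "\<exists>C :: 'a vec set. GRS_code n k C \<and> code_dim n (hermitian_hull q n C) = l"
    and "0 \<le> l" and "l \<le> k"
    and "1 \<le> i" and "i \<le> min l (q ^ 2 + 1 - n)"
    and "0 \<le> s" and "s \<le> l - i"
  shows "\<exists>C' :: 'a vec set. MDS_code (n + i) (k + i) C' \<and>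
           code_dim (n + i) (hermitian_hull q (n + i) C') = s"
proof -
  interpret hermitian_field q "TYPE('a)" using assms(1-3) by unfold_locales
  obtain C :: "'a vec set" where C: "GRS_code n k C" "code_dim n (hermitian_hull q n C) = l"
    using assms(4) by blast
  have "subspace_vec n C" using GRS_code_mds[OF C(1)] by (simp add: mds_def)
  then have cC: "card (hermitian_hull q n C) = CARD('a) ^ l"
    using card_subspace_vec[OF subspace_hermitian_hull] C(2) by blast
  \<comment> \<open>Because \<open>1 \<le> i\<close>, the truncated difference
    \<open>q ^ 2 + 1 - n\<close> is positive, so the bound on \<open>n + i\<close> can be recovered
    from it.\<close>
  have il: "i \<le> l" "n + i \<le> CARD('a) + 1" using assms(7,8,3) by auto
  obtain C1 :: "'a vec set" where C1: "mds (n + i) (k + i) C1"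
    "CARD('a) ^ l \<le> CARD('a) ^ i * card (hermitian_hull q (n + i) C1)"
    using mds_extension_exists[OF C(1) assms(7) il(2)] cC by auto
  \<comment> \<open>The extension gives only the lower bound \<open>l - i\<close> for
    \<open>d\<close>, not its value; the surplus \<open>d - s\<close> is removed afterwards.\<close>
  define d where "d = code_dim (n + i) (hermitian_hull q (n + i) C1)"
  have cC1: "card (hermitian_hull q (n + i) C1) = CARD('a) ^ d"
    using card_subspace_vec[OF subspace_hermitian_hull] C1(1) by (auto simp: mds_def d_def)
  then have "CARD('a) ^ l \<le> CARD('a) ^ (i + d)" using C1(2) by (simp add: power_add)
  then have "l \<le> i + d" using one_less_CARD[where 'a = 'a] by (rule power_le_imp_le_exp[rotated])
  then have "s \<le> d" using assms(10) by simp
  then have "card (hermitian_hull q (n + i) C1) = CARD('a) ^ (s + (d - s))" using cC1 by simp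
  then obtain C2 :: "'a vec set" where C2: "mds (n + i) (k + i) C2"
    "card (hermitian_hull q (n + i) C2) = CARD('a) ^ s"
    using mds_hull_reduce[OF C1(1)] by blast
  have "code_dim (n + i) (hermitian_hull q (n + i) C2) = s"
    using C2 by (intro code_dim_eqI subspace_hermitian_hull) (auto simp: mds_def)
  then show ?thesis using mds_imp_MDS_code[OF C2(1)] by blast
qed

end
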